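(* Let $\mathbb{P}_n=\sum_{i\in\mathcal I}p_i\delta_{\xi_i}$, $\mathcal I=\{1,\dots,n\}$, be the discrete scenario distribution of the two-stage stochastic program $\min_{x\in\mathcal X} f(x)+\sum_{i\in\mathcal I}p_iG(x,\xi_i)$ described in the context. Let $\mathcal{Q}_1=\{\mathbb{Q}_1^j : j\in\mathcal I\}$ denote the family of probability distributions obtained by drawing a single scenario from $\mathbb{P}_n$ (so $\mathbb{Q}_1^j=\delta_{\zeta_j}$ with $\zeta_j=\xi_j$), and let $j^*$ be the first scenario drawn using the Forward Selection Algorithm (given in the context) and the cost function $$c^{\mathrm{Pr}}(\xi_i,\zeta_j)=z(x^*(\zeta_j),\xi_i)-z(x^*(\xi_i),\xi_i).$$ Then the distribution $\mathbb{Q}_1^{j^*}$ minimizes the relative approximation error $\mathrm{RAE}$ for $m=1$, such that $$\mathbb{Q}_1^{j^*}=\arg\min_{\mathbb{Q}_1\in\mathcal{Q}_1}\mathrm{RAE}(\mathbb{P}_n,\mathbb{Q}_1).$$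
   Context: **Convention.** "$y=\arg\min\dots$" means that $y$ is a (chosen) minimizer; minimizers of the optimization problems below are understood to exist. **Two-stage problem.** The random variable $\xi$ has the finite discrete distribution $\mathbb{P}_n=\sum_{i\in\mathcal I}p_i\delta_{\xi_i}$, where $\mathcal I=\{1,\dots,n\}$, $\xi_i\in\mathbb{R}^d$ is the location of scenario $i$, $p_i$ its probability, and $\delta_{\xi_i}$ is the Dirac distribution allocating unit mass at $\xi_i$. The two-stage stochastic program is $$\min_{x\in\mathcal X} f(x)+\sum_{i\in\mathcal I}p_iG(x,\xi_i),$$ where $\mathcal X$ is defined by a set of mixed-integer linear constraints, $f(x)$ is the first-stage cost, and $G(x,\xi_i)$ is the optimal value of the second-stage linear program $$\min_{v}\ a^\top v\quad\text{s.t.}\quad Wv\ge h^{\xi_i}-Tx,\quad v\ge 0.$$ The cost vector $a$ and the matrices $W,T$ do not depend on the scenario; only the right-hand side $h^{\xi_i}$ does. The second-stage problem is feasible for every $x\in\mathcal X$ (relatively complete recourse). **Notation.** For $x\in\mathcal X$ and a scenario $\xi_i$, write $z(x,\xi_i)=f(x)+G(x,\xi_i)$. For a distribution $\mathbb{Q}=\sum_{j\in\mathcal J}q_j\delta_{\zeta_j}$ supported on finitely many scenarios, write $$z^*(x,\mathbb{Q})=\sum_{j\in\mathcal J}q_j\,z(x,\zeta_j)\quad(x\in\mathcal X),\qquad z^*(\mathbb{Q})=\min_{x\in\mathcal X}z^*(x,\mathbb{Q}),\qquad x^*(\mathbb{Q})=\arg\min_{x\in\mathcal X}z^*(x,\mathbb{Q}).$$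 For a single scenario $\xi_i$, $x^*(\xi_i)=\arg\min_{x\in\mathcal X}z(x,\xi_i)$ is the optimal first-stage decision of the single-scenario deterministic problem. One optimal decision is fixed per problem; since the two-stage problem under $\delta_\zeta$ is identical to the single-scenario problem for $\zeta$, $x^*(\delta_\zeta)=x^*(\zeta)$. **Relative approximation error.** For a distribution $\mathbb{Q}_m$ supported on $m$ scenarios, $$\mathrm{RAE}(\mathbb{P}_n,\mathbb{Q}_m)=\frac{z^*(x^*(\mathbb{Q}_m),\mathbb{P}_n)-z^*(\mathbb{P}_n)}{z^*(\mathbb{P}_n)},\qquad z^*(x^*(\mathbb{Q}_m),\mathbb{P}_n)=\sum_{i\in\mathcal I}p_i\,z(x^*(\mathbb{Q}_m),\xi_i).$$ This metric is only well defined when $z^*(\mathbb{P}_n)\neq 0$. **Forward Selection Algorithm.** Inputs: $\mathbb{P}_n$, a number $m$, and a cost function $c(\xi_i,\zeta_j)$ for $i,j\in\mathcal I$, where $\zeta_j=\xi_j$. Start with $\mathcal J=\emptyset$. While $|\mathcal J|<m$: set $\mathcal R=\mathcal I\setminus\mathcal J$, choose $$j=\arg\min_{j'\in\mathcal R}\ \sum_{i\in\mathcal R\setminus\{j'\}}p_i\min_{j''\in\mathcal J\cup\{j'\}}c(\xi_i,\zeta_{j''}),$$ and replace $\mathcal J$ by $\mathcal J\cup\{j\}$. Afterwards, each $j\in\mathcal J$ receives probability $q_j=p_j+\sum_{i\in\mathcal I_j}p_i$, where $\mathcal I_j=\{i\in\mathcal I\setminus\mathcal J: j=\arg\min_{j'\in\mathcal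 J}c(\xi_i,\zeta_{j'})\}$. The algorithm returns $\mathbb{Q}_m=\sum_{j\in\mathcal J}q_j\delta_{\zeta_j}$. The first scenario drawn is the index $j$ chosen in the first pass of the while loop (when $\mathcal J=\emptyset$ and $\mathcal R=\mathcal I$).
   Formalization: The optimal value z*(P_n) is assumed positive rather than merely nonzero; for z*(P_n)<0 minimizing RAE maximizes the true cost and the claim fails (e.g. f=-10, G=|x-ξ|, x in [0,1], scenarios 0 and 1 with probabilities 1/3 and 2/3). *)

theory Defs
  imports "HOL-Probability.Probability"
begin

text \<open>
  Data of a two-stage stochastic program. The first-stage feasible set is the mixed-integer
  linear set of all \<open>x\<close> with \<open>con_mat *v x \<ge> con_rhs\<close> whose coordinates in \<open>int_vars\<close> are
  integral; an equality constraint is a pair of opposite inequalities. \<open>'x\<close> and \<open>'v\<close> index the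
  first- and second-stage variables, \<open>'k\<close> and \<open>'r\<close> the constraints of the two stages, \<open>'d\<close> the
  coordinates of a scenario.
\<close>
record ('x, 'k, 'v, 'r, 'd) two_stage =
  con_mat :: "real^'x::finite^'k::finite"
  con_rhs :: "real^'k::finite"
  int_vars :: "'x::finite set"
  first_cost :: "real^'x::finite \<Rightarrow> real"
  second_cost :: "real^'v::finite"
  recourse_mat :: "real^'v::finite^'r::finite"
  tech_mat :: "real^'x::finite^'r::finite"
  rhs :: "real^'d::finite \<Rightarrow> real^'r::finite"

definition first_stage :: "('x::finite, 'k::finite, 'v::finite, 'r::finite, 'd::finite) two_stage
    \<Rightarrow> (real^'x) set" where
  "first_stage D = {x. con_mat D *v x \<ge> con_rhs D \<and> (\<forall>k\<in>int_vars D. x $ k \<in> \<int>)}"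

text \<open>The order on \<open>real^'r\<close> and \<open>real^'v\<close> is componentwise.\<close>
definition second_stage :: "('x::finite, 'k::finite, 'v::finite, 'r::finite, 'd::finite) two_stage
    \<Rightarrow> real^'x \<Rightarrow> real^'d \<Rightarrow> (real^'v) set" where
  "second_stage D x \<zeta> = {v. recourse_mat D *v v \<ge> rhs D \<zeta> - tech_mat D *v x \<and> v \<ge> 0}"

text \<open>
  Optimal values are infima, hence the minima whenever minimizers exist (existence is always
  assumed separately).
\<close>
definition G_val :: "('x::finite, 'k::finite, 'v::finite, 'r::finite, 'd::finite) two_stage
    \<Rightarrow> real^'x \<Rightarrow> real^'d \<Rightarrow> real" where
  "G_val D x \<zeta> = (INF v\<in>second_stage D x \<zeta>. second_cost D \<bullet> v)"

definition z_scen :: "('x::finite, 'k::finite, 'v::finite, 'r::finite, 'd::finite) two_stage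
    \<Rightarrow> real^'x \<Rightarrow> real^'d \<Rightarrow> real" where
  "z_scen D x \<zeta> = first_cost D x + G_val D x \<zeta>"

text \<open>The distribution \<open>\<Sum>i\<in>I. p i * \<delta>(\<xi> i)\<close>; the locations \<open>\<xi> i\<close> need not be distinct.
  Meaningful only for nonnegative weights with sum one.\<close>
definition discrete_distr :: "nat set \<Rightarrow> (nat \<Rightarrow> real) \<Rightarrow> (nat \<Rightarrow> 's) \<Rightarrow> 's pmf" where
  "discrete_distr I p \<xi> = embed_pmf (\<lambda>y. \<Sum>i\<in>I. p i * pmf (return_pmf (\<xi> i)) y)"

definition z_distr :: "('x::finite, 'k::finite, 'v::finite, 'r::finite, 'd::finite) two_stage
    \<Rightarrow> real^'x \<Rightarrow> (real^'d) pmf \<Rightarrow> real" where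
  "z_distr D x Q = measure_pmf.expectation Q (z_scen D x)"

definition z_opt :: "('x::finite, 'k::finite, 'v::finite, 'r::finite, 'd::finite) two_stage
    \<Rightarrow> (real^'d) pmf \<Rightarrow> real" where
  "z_opt D Q = (INF x\<in>first_stage D. z_distr D x Q)"

text \<open>
  The choice of optimal first-stage decisions is an explicit parameter: \<open>xQ\<close> assigns the chosen
  decision to a distribution and \<open>xS\<close> to a single scenario.
  The denominator of \<open>RAE\<close> is signed: a smaller error means a better decision only when
  \<open>z_opt D P > 0\<close>.
\<close>
definition RAE :: "('x::finite, 'k::finite, 'v::finite, 'r::finite, 'd::finite) two_stage
    \<Rightarrow> ((real^'d) pmf \<Rightarrow> real^'x) \<Rightarrow> (real^'d) pmf \<Rightarrow> (real^'d) pmf \<Rightarrow> real" where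
  "RAE D xQ P Q = (z_distr D (xQ Q) P - z_opt D P) / z_opt D P"

definition c_Pr :: "('x::finite, 'k::finite, 'v::finite, 'r::finite, 'd::finite) two_stage
    \<Rightarrow> (real^'d \<Rightarrow> real^'x) \<Rightarrow> real^'d \<Rightarrow> real^'d \<Rightarrow> real" where
  "c_Pr D xS \<xi> \<zeta> = z_scen D (xS \<zeta>) \<xi> - z_scen D (xS \<xi>) \<xi>"

definition single_draws :: "nat \<Rightarrow> (nat \<Rightarrow> 's) \<Rightarrow> 's pmf set" where
  "single_draws n \<xi> = (\<lambda>j. return_pmf (\<xi> j)) ` {1..n}"

definition fs_objective :: "nat \<Rightarrow> (nat \<Rightarrow> real) \<Rightarrow> (nat \<Rightarrow> 's) \<Rightarrow> ('s \<Rightarrow> 's \<Rightarrow> real)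
    \<Rightarrow> nat set \<Rightarrow> nat \<Rightarrow> real" where
  "fs_objective n p \<xi> c J j' =
     (\<Sum>i\<in>({1..n} - J) - {j'}. p i * Min ((\<lambda>j''. c (\<xi> i) (\<xi> j'')) ` (J \<union> {j'})))"

text \<open>
  Ties may be broken arbitrarily, so the algorithm is a relation: \<open>js\<close> lists the drawn indices in
  the order of the draws (the set \<open>J\<close> before pass \<open>k\<close> is \<open>set (take k js)\<close>), \<open>near i\<close> is the drawn
  index to which the undrawn index \<open>i\<close> is assigned, and \<open>Q\<close> is the returned distribution.
\<close>
definition forward_selection :: "nat \<Rightarrow> (nat \<Rightarrow> real) \<Rightarrow> (nat \<Rightarrow> 's) \<Rightarrow> nat
    \<Rightarrow> ('s \<Rightarrow> 's \<Rightarrow> real) \<Rightarrow> nat list \<Rightarrow> 's pmf \<Rightarrow> bool" where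
  "forward_selection n p \<xi> m c js Q \<longleftrightarrow>
     length js = m \<and>
     (\<forall>k<m. is_arg_min (fs_objective n p \<xi> c (set (take k js)))
               (\<lambda>j. j \<in> {1..n} - set (take k js)) (js ! k)) \<and>
     (\<exists>near.
        (\<forall>i\<in>{1..n} - set js. is_arg_min (\<lambda>j. c (\<xi> i) (\<xi> j)) (\<lambda>j. j \<in> set js) (near i)) \<and>
        Q = discrete_distr (set js)
              (\<lambda>j. p j + (\<Sum>i\<in>{i \<in> {1..n} - set js. near i = j}. p i)) \<xi>)"

end

theory Submission
  imports Defs
begin

text \<open>
  At the first pass the cost of a draw \<open>j\<close> differs from \<open>z_distr D (xS (\<xi> j)) P\<close> only by the
  wait-and-see value \<open>\<Sum>i. p i * z_scen D (xS (\<xi> i)) (\<xi> i)\<close>, which does not depend on \<open>j\<close>, and the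
  omitted summand \<open>i = j\<close> vanishes. Since \<open>RAE\<close> is an increasing affine function of
  \<open>z_distr D (xS (\<xi> j)) P\<close>, the two minimization problems over \<open>j\<close> have the same solutions.
\<close>

text \<open>\<open>embed_pmf\<close> is meaningful only for a nonnegative function of total mass
  one. Here the mass is \<open>sum p I\<close>, since every Dirac pmf integrates to 1.\<close>

lemma pmf_discrete_distr:
  assumes "\<And>i. i \<in> I \<Longrightarrow> p i \<ge> 0" "sum p I = 1"
  shows "pmf (discrete_distr I p \<xi>) y = (\<Sum>i\<in>I. p i * pmf (return_pmf (\<xi> i)) y)"
  unfolding discrete_distr_def
proof (rule pmf_embed_pmf)
  show "0 \<le> (\<Sum>i\<in>I. p i * pmf (return_pmf (\<xi> i)) x)" for x
    using assms(1) by (intro sum_nonneg mult_nonneg_nonneg) auto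
  have "(\<integral>\<^sup>+x. ennreal (\<Sum>i\<in>I. p i * pmf (return_pmf (\<xi> i)) x) \<partial>count_space UNIV)
      = (\<integral>\<^sup>+x. (\<Sum>i\<in>I. ennreal (p i) * ennreal (pmf (return_pmf (\<xi> i)) x)) \<partial>count_space UNIV)"
    using assms(1) by (intro nn_integral_cong) (simp add: sum_ennreal flip: ennreal_mult)
  also have "\<dots> = (\<Sum>i\<in>I. ennreal (p i))"
    by (simp add: nn_integral_sum nn_integral_cmult nn_integral_pmf_eq_1 del: pmf_return)
  also have "\<dots> = 1"
    using assms by (simp add: sum_ennreal)
  finally show "(\<integral>\<^sup>+x. ennreal (\<Sum>i\<in>I. p i * pmf (return_pmf (\<xi> i)) x) \<partial>count_space UNIV) = 1" .
qed

text \<open>Locations may coincide, so the expectation is first taken over the set of distinct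
  points. Exchanging the two sums then returns to indices, and coinciding points need no separate
  treatment.\<close>

lemma expectation_discrete_distr:
  fixes g :: "'s \<Rightarrow> real"
  assumes "\<And>i. i \<in> I \<Longrightarrow> p i \<ge> 0" "sum p I = 1"
  shows "measure_pmf.expectation (discrete_distr I p \<xi>) g = (\<Sum>i\<in>I. p i * g (\<xi> i))"
proof -
  \<comment> \<open>The sum over an infinite set is 0 by convention, which contradicts total weight
    1.\<close>
  have fin: "finite I"
    using assms(2) by (metis sum.infinite zero_neq_one)
  note pmf = pmf_discrete_distr[OF assms]
  have "measure_pmf.expectation (discrete_distr I p \<xi>) g
      = (\<Sum>y\<in>\<xi> ` I. g y * pmf (discrete_distr I p \<xi>) y)"
  proof (rule integral_measure_pmf_real)
    fix y assume "y \<in> set_pmf (discrete_distr I p \<xi>)"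
    then have "(\<Sum>i\<in>I. p i * pmf (return_pmf (\<xi> i)) y) \<noteq> 0"
      by (simp add: set_pmf_iff pmf)
    then obtain i where "i \<in> I" "p i * pmf (return_pmf (\<xi> i)) y \<noteq> 0"
      by (meson sum.neutral)
    then show "y \<in> \<xi> ` I"
      by (auto simp: indicator_def split: if_splits)
  qed (use fin in simp)
  also have "\<dots> = (\<Sum>i\<in>I. \<Sum>y\<in>\<xi> ` I. g y * (p i * pmf (return_pmf (\<xi> i)) y))"
    by (subst sum.swap) (simp add: pmf sum_distrib_left)
  \<comment> \<open>For fixed \<open>i\<close>, the Dirac pmf leaves only the point
    \<open>y = \<xi> i\<close>, which occurs exactly once in the image.\<close>
  also have "\<dots> = (\<Sum>i\<in>I. \<Sum>y\<in>\<xi> ` I. if y = \<xi> i then p i * g (\<xi> i) else 0)"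
    by (intro sum.cong) (auto simp: indicator_def)
  also have "\<dots> = (\<Sum>i\<in>I. p i * g (\<xi> i))"
    using fin by (intro sum.cong) (auto simp: sum.delta)
  finally show ?thesis .
qed

text \<open>With nothing drawn yet, the inner \<open>Min\<close> ranges over a singleton. A zero
  cost on the diagonal allows the skipped index \<open>j\<close> to be put back into the
  sum.\<close>

lemma fs_objective_empty:
  assumes "j \<in> {1..n}" "c (\<xi> j) (\<xi> j) = 0"
  shows "fs_objective n p \<xi> c {} j = (\<Sum>i\<in>{1..n}. p i * c (\<xi> i) (\<xi> j))"
  using assms by (simp add: fs_objective_def sum.remove[of _ j])

lemma forward_selection_first:
  assumes "forward_selection n p \<xi> m c js Q" "m \<ge> 1"
  shows "is_arg_min (fs_objective n p \<xi> c {}) (\<lambda>j. j \<in> {1..n}) (js ! 0)"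
proof -
  have "is_arg_min (fs_objective n p \<xi> c (set (take 0 js)))
      (\<lambda>j. j \<in> {1..n} - set (take 0 js)) (js ! 0)"
    using assms unfolding forward_selection_def by (metis less_le_trans zero_less_one)
  then show ?thesis
    by simp
qed

theorem theorem1:
  fixes D :: "('x::finite, 'k::finite, 'v::finite, 'r::finite, 'd::finite) two_stage"
    and n m :: nat
    and p :: "nat \<Rightarrow> real"
    and \<xi> :: "nat \<Rightarrow> real^'d"
    and P Q :: "(real^'d) pmf"
    and xS :: "real^'d \<Rightarrow> real^'x"
    and xQ :: "(real^'d) pmf \<Rightarrow> real^'x"
    and js :: "nat list"
  assumes p_nonneg: "\<And>i. i \<in> {1..n} \<Longrightarrow> p i \<ge> 0"
    and p_sum: "(\<Sum>i\<in>{1..n}. p i) = 1"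
    and P_def: "P = discrete_distr {1..n} p \<xi>"
    and recourse: "\<And>x i. x \<in> first_stage D \<Longrightarrow> i \<in> {1..n} \<Longrightarrow> second_stage D x (\<xi> i) \<noteq> {}"
    and second_stage_min: "\<And>x i. x \<in> first_stage D \<Longrightarrow> i \<in> {1..n} \<Longrightarrow>
      \<exists>v. is_arg_min (\<lambda>v. second_cost D \<bullet> v) (\<lambda>v. v \<in> second_stage D x (\<xi> i)) v"
    and xS_min: "\<And>i. i \<in> {1..n} \<Longrightarrow>
      is_arg_min (\<lambda>x. z_scen D x (\<xi> i)) (\<lambda>x. x \<in> first_stage D) (xS (\<xi> i))"
    and xQ_min: "\<And>R. R \<in> insert P (single_draws n \<xi>) \<Longrightarrow>
      is_arg_min (\<lambda>x. z_distr D x R) (\<lambda>x. x \<in> first_stage D) (xQ R)"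
    and xQ_dirac: "\<And>i. i \<in> {1..n} \<Longrightarrow> xQ (return_pmf (\<xi> i)) = xS (\<xi> i)"
    and z_opt_pos: "z_opt D P > 0"
    and m_pos: "m \<ge> 1"
    and FS: "forward_selection n p \<xi> m (c_Pr D xS) js Q"
  shows "is_arg_min (RAE D xQ P) (\<lambda>R. R \<in> single_draws n \<xi>) (return_pmf (\<xi> (js ! 0)))"
proof -
  define j where "j = js ! 0"
  let ?W = "\<Sum>i\<in>{1..n}. p i * z_scen D (xS (\<xi> i)) (\<xi> i)"
  have z: "z_distr D x P = (\<Sum>i\<in>{1..n}. p i * z_scen D x (\<xi> i))" for x
    unfolding z_distr_def P_def by (rule expectation_discrete_distr[OF p_nonneg p_sum])
  \<comment> \<open>\<open>c_Pr\<close> vanishes on the diagonal whatever decisions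
    \<open>xS\<close> selects, because its two terms then coincide.\<close>
  have obj: "fs_objective n p \<xi> (c_Pr D xS) {} k = z_distr D (xS (\<xi> k)) P - ?W"
    if "k \<in> {1..n}" for k
    using that
    by (subst fs_objective_empty) (simp_all add: c_Pr_def z right_diff_distrib sum_subtractf)
  have j_mem: "j \<in> {1..n}"
    using forward_selection_first[OF FS m_pos] by (simp add: is_arg_min_def j_def)
  have "fs_objective n p \<xi> (c_Pr D xS) {} j \<le> fs_objective n p \<xi> (c_Pr D xS) {} k"
    if "k \<in> {1..n}" for k
    using forward_selection_first[OF FS m_pos] that
    by (auto simp: is_arg_min_linorder j_def)
  then have j_min: "z_distr D (xS (\<xi> j)) P \<le> z_distr D (xS (\<xi> k)) P" if "k \<in> {1..n}" for k
    using that obj j_mem by force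
  \<comment> \<open>Consistency of the choices on Dirac distributions turns \<open>xQ\<close> into
    \<open>xS\<close>; the positive sign of \<open>z_opt D P\<close> preserves the inequality under
    division.\<close>
  have "RAE D xQ P (return_pmf (\<xi> j)) \<le> RAE D xQ P (return_pmf (\<xi> k))" if "k \<in> {1..n}" for k
    unfolding RAE_def xQ_dirac[OF that] xQ_dirac[OF j_mem]
    using j_min[OF that] z_opt_pos by (intro divide_right_mono) auto
  then show ?thesis
    using j_mem by (auto simp: is_arg_min_linorder single_draws_def j_def)
qed

end
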